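(* Let $\alpha\in Q_n^\kappa$ and assume that $\#[\alpha]=p$. For $\lambda\in\mathcal{P}^\kappa_\alpha$ and $\mathfrak{s},\mathfrak{t}\in\mathcal{T}(\lambda)$ set $d^\lambda_{\mathfrak{s}\mathfrak{t}}:=\mu(c^\lambda_{\mathfrak{s}\mathfrak{t}})$. Then the triple $(\mathcal{P}^\kappa_\alpha,\mathcal{T},d)$ is a cellular datum for $\mathcal{H}^\kappa_{p,[\alpha]}$.
   Context: Combinatorics. Let $d,\eta,p,n\geq 1$ be integers, $e:=\eta p\ge 2$, $r:=dp$ (the integer $d$ is not to be confused with the family $d^\lambda_{\mathfrak{s}\mathfrak{t}}$ of the claim); identify $\mathbb{Z}/e\mathbb{Z}$ with $\{0,\dots,e-1\}$ and $\mathbb{Z}/r\mathbb{Z}$ with $\{0,\dots,r-1\}$. Let $\kappa=(\kappa_0,\dots,\kappa_{r-1})\in(\mathbb{Z}/e\mathbb{Z})^r$ satisfy $\kappa_{k+d}=\kappa_k+\eta$ for all $k\in\mathbb{Z}/r\mathbb{Z}$. An $r$-partition of $n$ is an $r$-tuple $\lambda=(\lambda^{(0)},\dots,\lambda^{(r-1)})$ of partitions of total size $n$; $\mathcal{P}_n^\kappa$ is the set of these. Its Young diagram is $\mathcal{Y}(\lambda)=\{(a,b,c)\in \mathbb{N}^2\times\{0,\dots,r-1\} : a\text{ indexes a row of }\lambda^{(c)},\ 0\le b\le\lambda^{(c)}_a-1\}$ (rows indexed from $0$), and $\mathrm{res}_\kappa(a,b,c)=b-a+\kappa_c\in\mathbb{Z}/e\mathbb{Z}$.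 Let $Q^+=\bigoplus_{i\in\mathbb{Z}/e\mathbb{Z}}\mathbb{N}\alpha_i$, $\alpha_\kappa(\lambda)=\sum_{\gamma\in\mathcal{Y}(\lambda)}\alpha_{\mathrm{res}_\kappa(\gamma)}$, $Q^\kappa_n=\{\alpha_\kappa(\lambda):\lambda\in\mathcal{P}^\kappa_n\}$ and $\mathcal{P}_\alpha^\kappa=\{\lambda:\alpha_\kappa(\lambda)=\alpha\}$. The shift on $Q^+$ is the additive map with $\sigma\cdot\alpha_i=\alpha_{i+\eta}$, and $[\alpha]$ is the orbit of $\alpha$. A standard $\lambda$-tableau is a bijection $\mathfrak{t}:\mathcal{Y}(\lambda)\to\{1,\dots,n\}$ increasing along rows and down columns in each component; $\mathcal{T}(\lambda)$ is the set of these, and $\mathrm{res}_\kappa(\mathfrak{t})=(\mathrm{res}_\kappa(\mathfrak{t}^{-1}(a)))_{1\le a\le n}$. Cellular algebras (Graham--Lehrer). Let $A$ be a finite-dimensional unital associative $F$-algebra. A cellular datum for $A$ is a triple $(\Lambda,\mathcal{T},c)$ where: $\Lambda$ is a finite partially ordered set; for each $\lambda\in\Lambda$ there is an indexing set $\mathcal{T}(\lambda)$ and distinct elements $c^\lambda_{\mathfrak{s}\mathfrak{t}}\in A$ ($\mathfrak{s},\mathfrak{t}\in\mathcal{T}(\lambda)$) such that $\{c^\lambda_{\mathfrak{s}\mathfrak{t}}\}$ (over all $\lambda,\mathfrak{s},\mathfrak{t}$) is an $F$-basis of $A$; for all $\lambda$, $\mathfrak{t}\in\mathcal{T}(\lambda)$,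 $a\in A$ there are scalars $r_{\mathfrak{t}\mathfrak{v}}(a)\in F$ with, for all $\mathfrak{s}\in\mathcal{T}(\lambda)$, $c^\lambda_{\mathfrak{s}\mathfrak{t}}a\equiv\sum_{\mathfrak{v}\in\mathcal{T}(\lambda)}r_{\mathfrak{t}\mathfrak{v}}(a)c^\lambda_{\mathfrak{s}\mathfrak{v}}$ modulo the span of the $c^\nu_{\mathfrak{a}\mathfrak{b}}$ with $\nu>\lambda$; and the linear map $*$ with $(c^\lambda_{\mathfrak{s}\mathfrak{t}})^*=c^\lambda_{\mathfrak{t}\mathfrak{s}}$ is an algebra anti-automorphism of $A$. Algebra. Let $F$ be a field and $q\in F\setminus\{0,1\}$ of multiplicative order $e$. The Ariki--Koike algebra $\mathcal{H}_n^\kappa$ is the unital associative $F$-algebra with generators $S,T_1,\dots,T_{n-1}$ and relations $\prod_{k=0}^{r-1}(S-q^{\kappa_k})=0$, $ST_1ST_1=T_1ST_1S$, $ST_a=T_aS$ for $a\ge 2$, $(T_a+1)(T_a-q)=0$, $T_aT_b=T_bT_a$ for $|a-b|>1$, $T_aT_{a+1}T_a=T_{a+1}T_aT_{a+1}$. Let $\zeta\in F^\times$ have order $p$ and let $\sigma$ be the algebra automorphism of $\mathcal{H}_n^\kappa$ of order $p$ with $\sigma(S)=\zeta S$, $\sigma(T_a)=T_a$. Put $\mu=\sum_{j=0}^{p-1}\sigma^j:\mathcal{H}_n^\kappa\to\mathcal{H}_n^\kappa$. By known results (Brundan--Kleshchev, Rostam) $\mathcal{H}_n^\kappa$ is generated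 by elements (the Khovanov--Lauda generators) $e(\mathbf{i})$ for $\mathbf{i}\in(\mathbb{Z}/e\mathbb{Z})^n$, $\psi_1,\dots,\psi_{n-1}$, $y_1,\dots,y_n$, such that the $e(\mathbf{i})$ form a complete system of orthogonal idempotents and $\sigma(e(\mathbf{i}))=e(\mathbf{i}-(\eta,\dots,\eta))$, $\sigma(\psi_a)=\psi_a$, $\sigma(y_a)=y_a$. Let $*$ be the algebra anti-automorphism of $\mathcal{H}^\kappa_n$ fixing each of these generators. By known results (Hu--Mathas) there is a cellular datum $(\mathcal{P}^\kappa_n,\mathcal{T},c)$ for $\mathcal{H}_n^\kappa$ (for some partial order on $\mathcal{P}^\kappa_n$) with associated anti-automorphism $*$ and with $c^\lambda_{\mathfrak{s}\mathfrak{t}}\in e(\mathrm{res}_\kappa(\mathfrak{s}))\mathcal{H}_n^\kappa e(\mathrm{res}_\kappa(\mathfrak{t}))$ for all $\lambda\in\mathcal{P}_n^\kappa$ and $\mathfrak{s},\mathfrak{t}\in\mathcal{T}(\lambda)$. These data are fixed; $\mathcal{P}^\kappa_\alpha$ carries the restricted partial order. For $\beta=\sum_i\beta_i\alpha_i\in Q^+$ with $\sum_i\beta_i=n$, let $I^\beta\subseteq(\mathbb{Z}/e\mathbb{Z})^n$ be the set of tuples having exactly $\beta_i$ components equal to $i$ for every $i$, and $\mathcal{H}^\kappa_\beta=\sum_{\mathbf{i},\mathbf{j}\in I^\beta}e(\mathbf{i})\mathcal{H}^\kappa_ne(\mathbf{j})$; when $\beta\in Q^\kappa_n$, $(\mathcal{P}_\beta^\kappa,\mathcal{T},c)$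 is a cellular datum for the algebra $\mathcal{H}^\kappa_\beta$. For $\alpha\in Q^\kappa_n$ put $\mathcal{H}^\kappa_{[\alpha]}=\bigoplus_{\beta\in[\alpha]}\mathcal{H}^\kappa_\beta$, which is $\sigma$-stable, and let $\mathcal{H}^\kappa_{p,[\alpha]}$ be its subalgebra of elements fixed by $\sigma$. *)

theory Defs
  imports Complex_Main "HOL-Library.Multiset" "HOL-Library.FuncSet" "HOL-Library.Poly_Mapping"
begin

section \<open>Combinatorics of \<open>r\<close>-partitions\<close>

text \<open>
  \<open>\<int>/e\<int>\<close> is the set \<open>{0..<e}\<close> of integers, \<open>\<int>/r\<int>\<close> the set \<open>{0..<r}\<close> of naturals; a partition is the
  weakly decreasing list of its positive parts.
\<close>

definition is_partition :: "nat list \<Rightarrow> bool" where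
  "is_partition \<nu> \<longleftrightarrow> sorted_wrt (\<ge>) \<nu> \<and> 0 \<notin> set \<nu>"

definition multipartitions :: "nat \<Rightarrow> nat \<Rightarrow> nat list list set" where
  "multipartitions r n =
     {lam. length lam = r \<and> (\<forall>\<nu>\<in>set lam. is_partition \<nu>) \<and> (\<Sum>\<nu>\<leftarrow>lam. sum_list \<nu>) = n}"

type_synonym node = "nat \<times> nat \<times> nat"

definition young_diagram :: "nat list list \<Rightarrow> node set" where
  "young_diagram lam = {(a, b, c). c < length lam \<and> a < length (lam ! c) \<and> b < lam ! c ! a}"

definition res_node :: "nat \<Rightarrow> (nat \<Rightarrow> int) \<Rightarrow> node \<Rightarrow> int" where
  "res_node e \<kappa> = (\<lambda>(a, b, c). (int b - int a + \<kappa> c) mod int e)"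

text \<open>
  \<open>Q\<^sup>+\<close> is the free commutative monoid on the \<open>\<alpha>\<^sub>i\<close>, that is, the finite multisets of residues, with
  \<open>\<alpha>\<^sub>i = {#i#}\<close>.
\<close>

definition content :: "nat \<Rightarrow> (nat \<Rightarrow> int) \<Rightarrow> nat list list \<Rightarrow> int multiset" where
  "content e \<kappa> lam = (\<Sum>\<gamma>\<in>young_diagram lam. {#res_node e \<kappa> \<gamma>#})"

definition contents :: "nat \<Rightarrow> (nat \<Rightarrow> int) \<Rightarrow> nat \<Rightarrow> nat \<Rightarrow> int multiset set" where
  "contents e \<kappa> r n = content e \<kappa> ` multipartitions r n"

definition multipartitions_of_content ::
    "nat \<Rightarrow> (nat \<Rightarrow> int) \<Rightarrow> nat \<Rightarrow> nat \<Rightarrow> int multiset \<Rightarrow> nat list list set" where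
  "multipartitions_of_content e \<kappa> r n \<alpha> = {lam \<in> multipartitions r n. content e \<kappa> lam = \<alpha>}"

definition shift :: "nat \<Rightarrow> nat \<Rightarrow> int multiset \<Rightarrow> int multiset" where
  "shift e \<eta> \<alpha> = image_mset (\<lambda>i. (i + int \<eta>) mod int e) \<alpha>"

text \<open>
  The shift has finite order on multisets of residues (\<open>\<eta>\<close> divides \<open>e\<close>), so its non-negative powers
  suffice to describe orbits.
\<close>

definition shift_orbit :: "nat \<Rightarrow> nat \<Rightarrow> int multiset \<Rightarrow> int multiset set" where
  "shift_orbit e \<eta> \<alpha> = {(shift e \<eta> ^^ j) \<alpha> | j. True}"

text \<open>
  Tableaux are taken in \<^const>\<open>extensional\<close>, so that they correspond exactly to the bijections defined on the
  Young diagram only.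
\<close>

definition standard_tableaux :: "nat \<Rightarrow> nat list list \<Rightarrow> (node \<Rightarrow> nat) set" where
  "standard_tableaux n lam = {\<tt>. \<tt> \<in> extensional (young_diagram lam) \<and>
      bij_betw \<tt> (young_diagram lam) {1..n} \<and>
      (\<forall>a b b' c. (a, b, c) \<in> young_diagram lam \<longrightarrow> (a, b', c) \<in> young_diagram lam \<longrightarrow> b < b' \<longrightarrow>
         \<tt> (a, b, c) < \<tt> (a, b', c)) \<and>
      (\<forall>a a' b c. (a, b, c) \<in> young_diagram lam \<longrightarrow> (a', b, c) \<in> young_diagram lam \<longrightarrow> a < a' \<longrightarrow>
         \<tt> (a, b, c) < \<tt> (a', b, c))}"

definition residue_tuples :: "nat \<Rightarrow> nat \<Rightarrow> (nat \<Rightarrow> int) set" where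
  "residue_tuples e n = {1..n} \<rightarrow>\<^sub>E {0..<int e}"

definition res_tableau ::
    "nat \<Rightarrow> (nat \<Rightarrow> int) \<Rightarrow> nat \<Rightarrow> nat list list \<Rightarrow> (node \<Rightarrow> nat) \<Rightarrow> nat \<Rightarrow> int" where
  "res_tableau e \<kappa> n lam \<tt> =
     (\<lambda>a\<in>{1..n}. res_node e \<kappa> (inv_into (young_diagram lam) \<tt> a))"

definition tuple_minus :: "nat \<Rightarrow> nat \<Rightarrow> nat \<Rightarrow> (nat \<Rightarrow> int) \<Rightarrow> nat \<Rightarrow> int" where
  "tuple_minus e \<eta> n i = (\<lambda>a\<in>{1..n}. (i a - int \<eta>) mod int e)"

definition tuples_of_content :: "nat \<Rightarrow> nat \<Rightarrow> int multiset \<Rightarrow> (nat \<Rightarrow> int) set" where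
  "tuples_of_content e n \<beta> =
     {i \<in> residue_tuples e n. \<forall>k\<in>{0..<int e}. card {a \<in> {1..n}. i a = k} = count \<beta> k}"


section \<open>Free algebras and presentations\<close>

text \<open>
  Words under concatenation form a monoid, so that \<open>'x list \<Rightarrow>\<^sub>0 'f\<close>, with the convolution product of
  \<^theory>\<open>HOL-Library.Poly_Mapping\<close>, is the free associative unital \<open>'f\<close>-algebra on \<open>'x\<close>.
\<close>

instantiation list :: (type) monoid_add
begin
definition zero_list :: "'a list" where "zero_list = []"
definition plus_list :: "'a list \<Rightarrow> 'a list \<Rightarrow> 'a list" where "plus_list = append"
instance by standard (simp_all add: zero_list_def plus_list_def)
end

definition free_algebra :: "'x set \<Rightarrow> ('x list \<Rightarrow>\<^sub>0 'f::field) set" where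
  "free_algebra X = {P. Poly_Mapping.keys P \<subseteq> lists X}"

definition free_gen :: "'x \<Rightarrow> ('x list \<Rightarrow>\<^sub>0 'f::field)" where
  "free_gen x = Poly_Mapping.single [x] 1"

definition free_const :: "'f::field \<Rightarrow> ('x list \<Rightarrow>\<^sub>0 'f)" where
  "free_const k = Poly_Mapping.single [] k"

definition two_sided_ideal :: "'b::ring_1 set \<Rightarrow> 'b set \<Rightarrow> bool" where
  "two_sided_ideal R J \<longleftrightarrow> J \<subseteq> R \<and> 0 \<in> J \<and> (\<forall>x\<in>J. \<forall>y\<in>J. x + y \<in> J) \<and> (\<forall>x\<in>J. - x \<in> J) \<and>
     (\<forall>a\<in>R. \<forall>x\<in>J. a * x \<in> J \<and> x * a \<in> J)"

datatype ak_gen = Gen_S | Gen_T nat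

definition ak_generators :: "nat \<Rightarrow> ak_gen set" where
  "ak_generators n = {Gen_S} \<union> Gen_T ` {1..<n}"

text \<open>Each relation \<open>u = v\<close> is recorded as the element \<open>u - v\<close> of the free algebra.\<close>

definition ak_relations ::
    "nat \<Rightarrow> nat \<Rightarrow> 'f::field \<Rightarrow> (nat \<Rightarrow> int) \<Rightarrow> (ak_gen list \<Rightarrow>\<^sub>0 'f) set" where
  "ak_relations r n q \<kappa> = (let S = free_gen Gen_S; T = (\<lambda>a. free_gen (Gen_T a)) in
     {\<Prod>k\<leftarrow>[0..<r]. (S - free_const (q ^ nat (\<kappa> k)))}
     \<union> (if 1 < n then {S * T 1 * S * T 1 - T 1 * S * T 1 * S} else {})
     \<union> {S * T a - T a * S | a. 2 \<le> a \<and> a < n}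
     \<union> {(T a + 1) * (T a - free_const q) | a. 1 \<le> a \<and> a < n}
     \<union> {T a * T b - T b * T a | a b. 1 \<le> a \<and> a < n \<and> 1 \<le> b \<and> b < n \<and> \<bar>int a - int b\<bar> > 1}
     \<union> {T a * T (a + 1) * T a - T (a + 1) * T a * T (a + 1) | a. 1 \<le> a \<and> a + 1 < n})"

definition has_mult_order :: "'f::field \<Rightarrow> nat \<Rightarrow> bool" where
  "has_mult_order x m \<longleftrightarrow> 0 < m \<and> x ^ m = 1 \<and> (\<forall>k. 0 < k \<and> k < m \<longrightarrow> x ^ k \<noteq> 1)"


section \<open>Associative algebras and cellular data\<close>

locale assoc_algebra = vector_space scale
  for scale :: "'f::field \<Rightarrow> 'a::ring_1 \<Rightarrow> 'a" (infixr \<open>*s\<close> 75) +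
  assumes scale_mult_left: "(k *s x) * y = k *s (x * y)"
    and scale_mult_right: "x * (k *s y) = k *s (x * y)"
begin

definition free_eval :: "('x \<Rightarrow> 'a) \<Rightarrow> ('x list \<Rightarrow>\<^sub>0 'f) \<Rightarrow> 'a" where
  "free_eval g P = (\<Sum>w\<in>Poly_Mapping.keys P. Poly_Mapping.lookup P w *s (\<Prod>x\<leftarrow>w. g x))"

text \<open>
  The ambient algebra is presented by the generators \<open>X\<close>, sent to \<open>g\<close>, and the relations \<open>R\<close>: evaluation
  identifies it with the quotient of the free algebra by the two-sided ideal generated by \<open>R\<close>.
\<close>

definition presented_by :: "'x set \<Rightarrow> ('x \<Rightarrow> 'a) \<Rightarrow> ('x list \<Rightarrow>\<^sub>0 'f) set \<Rightarrow> bool" where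
  "presented_by X g R \<longleftrightarrow>
     free_eval g ` free_algebra X = UNIV \<and>
     {P \<in> free_algebra X. free_eval g P = 0} = two_sided_ideal (free_algebra X) hull R"

definition ariki_koike ::
    "nat \<Rightarrow> nat \<Rightarrow> 'f \<Rightarrow> (nat \<Rightarrow> int) \<Rightarrow> 'a \<Rightarrow> (nat \<Rightarrow> 'a) \<Rightarrow> bool" where
  "ariki_koike r n q \<kappa> S T \<longleftrightarrow>
     presented_by (ak_generators n) (case_ak_gen S T) (ak_relations r n q \<kappa>)"

definition unital_subalgebra :: "'a set \<Rightarrow> bool" where
  "unital_subalgebra B \<longleftrightarrow> subspace B \<and> 1 \<in> B \<and> (\<forall>x\<in>B. \<forall>y\<in>B. x * y \<in> B)"

definition algebra_automorphism :: "('a \<Rightarrow> 'a) \<Rightarrow> bool" where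
  "algebra_automorphism f \<longleftrightarrow> bij f \<and> (\<forall>x y. f (x + y) = f x + f y) \<and> (\<forall>k x. f (k *s x) = k *s f x) \<and>
     f 1 = 1 \<and> (\<forall>x y. f (x * y) = f x * f y)"

text \<open>
  A subset \<open>A\<close> that is an algebra under the ambient operations; its unit element may differ from that of
  the ambient algebra.
\<close>

definition fd_algebra_on :: "'a set \<Rightarrow> bool" where
  "fd_algebra_on A \<longleftrightarrow> subspace A \<and> (\<forall>x\<in>A. \<forall>y\<in>A. x * y \<in> A) \<and>
     (\<exists>u\<in>A. \<forall>x\<in>A. u * x = x \<and> x * u = x) \<and> (\<exists>B. finite B \<and> B \<subseteq> A \<and> span B = A)"

definition anti_automorphism_on :: "'a set \<Rightarrow> ('a \<Rightarrow> 'a) \<Rightarrow> bool" where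
  "anti_automorphism_on A f \<longleftrightarrow> bij_betw f A A \<and>
     (\<forall>x\<in>A. \<forall>y\<in>A. f (x + y) = f x + f y) \<and> (\<forall>k. \<forall>x\<in>A. f (k *s x) = k *s f x) \<and>
     (\<forall>x\<in>A. \<forall>y\<in>A. f (x * y) = f y * f x)"

text \<open>
  \<open>leq\<close> is the order relation on \<open>\<Lambda>\<close>, with \<open>(lam, \<nu>) \<in> leq\<close> for \<open>lam \<le> \<nu>\<close>.  Each \<open>Tab lam\<close> is finite, since \<open>A\<close> is
  finite-dimensional and the \<open>c lam \<ss> \<tt>\<close> are distinct members of a basis.
\<close>

definition cellular_datum_with ::
    "'a set \<Rightarrow> 'l set \<Rightarrow> ('l \<times> 'l) set \<Rightarrow> ('l \<Rightarrow> 't set) \<Rightarrow> ('l \<Rightarrow> 't \<Rightarrow> 't \<Rightarrow> 'a) \<Rightarrow> ('a \<Rightarrow> 'a) \<Rightarrow> bool" where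
  "cellular_datum_with A \<Lambda> leq Tab c star \<longleftrightarrow>
     fd_algebra_on A \<and> finite \<Lambda> \<and> partial_order_on \<Lambda> leq \<and>
     inj_on (\<lambda>(lam, \<ss>, \<tt>). c lam \<ss> \<tt>) (SIGMA lam:\<Lambda>. Tab lam \<times> Tab lam) \<and>
     independent {c lam \<ss> \<tt> | lam \<ss> \<tt>. lam \<in> \<Lambda> \<and> \<ss> \<in> Tab lam \<and> \<tt> \<in> Tab lam} \<and>
     span {c lam \<ss> \<tt> | lam \<ss> \<tt>. lam \<in> \<Lambda> \<and> \<ss> \<in> Tab lam \<and> \<tt> \<in> Tab lam} = A \<and>
     (\<forall>lam\<in>\<Lambda>. \<forall>\<tt>\<in>Tab lam. \<forall>a\<in>A. \<exists>\<rho>. \<forall>\<ss>\<in>Tab lam.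
        c lam \<ss> \<tt> * a - (\<Sum>\<vv>\<in>Tab lam. \<rho> \<vv> *s c lam \<ss> \<vv>)
          \<in> span {c \<nu> \<aa> \<bb> | \<nu> \<aa> \<bb>. \<nu> \<in> \<Lambda> \<and> (lam, \<nu>) \<in> leq \<and> \<nu> \<noteq> lam \<and> \<aa> \<in> Tab \<nu> \<and> \<bb> \<in> Tab \<nu>}) \<and>
     anti_automorphism_on A star \<and>
     (\<forall>lam\<in>\<Lambda>. \<forall>\<ss>\<in>Tab lam. \<forall>\<tt>\<in>Tab lam. star (c lam \<ss> \<tt>) = c lam \<tt> \<ss>)"

text \<open>
  The linear map on \<open>A\<close> exchanging \<open>c lam \<ss> \<tt>\<close> and \<open>c lam \<tt> \<ss>\<close> is unique, whence the existential quantifier.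
\<close>

definition cellular_datum ::
    "'a set \<Rightarrow> 'l set \<Rightarrow> ('l \<times> 'l) set \<Rightarrow> ('l \<Rightarrow> 't set) \<Rightarrow> ('l \<Rightarrow> 't \<Rightarrow> 't \<Rightarrow> 'a) \<Rightarrow> bool" where
  "cellular_datum A \<Lambda> leq Tab c \<longleftrightarrow> (\<exists>star. cellular_datum_with A \<Lambda> leq Tab c star)"

text \<open>
  The properties by which the Khovanov--Lauda generators are given; \<open>idem i\<close> stands for \<open>e(i)\<close>.
\<close>

definition kl_generators ::
    "nat \<Rightarrow> nat \<Rightarrow> nat \<Rightarrow> ('a \<Rightarrow> 'a) \<Rightarrow> ((nat \<Rightarrow> int) \<Rightarrow> 'a) \<Rightarrow> (nat \<Rightarrow> 'a) \<Rightarrow> (nat \<Rightarrow> 'a) \<Rightarrow> bool" where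
  "kl_generators e \<eta> n \<sigma> idem \<psi> y \<longleftrightarrow>
     unital_subalgebra hull (idem ` residue_tuples e n \<union> \<psi> ` {1..<n} \<union> y ` {1..n}) = UNIV \<and>
     (\<forall>i\<in>residue_tuples e n. \<forall>j\<in>residue_tuples e n. idem i * idem j = (if i = j then idem i else 0)) \<and>
     (\<Sum>i\<in>residue_tuples e n. idem i) = 1 \<and>
     (\<forall>i\<in>residue_tuples e n. \<sigma> (idem i) = idem (tuple_minus e \<eta> n i)) \<and>
     (\<forall>a\<in>{1..<n}. \<sigma> (\<psi> a) = \<psi> a) \<and>
     (\<forall>a\<in>{1..n}. \<sigma> (y a) = y a)"

end

text \<open>\<open>\<H>\<^sub>\<beta>\<close>, the sum of the subspaces \<open>e(i) \<H> e(j)\<close> over \<open>i, j \<in> I\<^sup>\<beta>\<close>.\<close>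

definition block :: "nat \<Rightarrow> nat \<Rightarrow> ((nat \<Rightarrow> int) \<Rightarrow> 'a::ring_1) \<Rightarrow> int multiset \<Rightarrow> 'a set" where
  "block e n idem \<beta> =
     {\<Sum>i\<in>tuples_of_content e n \<beta>. \<Sum>j\<in>tuples_of_content e n \<beta>. idem i * h i j * idem j | h. True}"

text \<open>\<open>\<H>\<close> at the orbit of \<open>\<alpha>\<close>; the sum is direct by orthogonality of the idempotents.\<close>

definition orbit_block ::
    "nat \<Rightarrow> nat \<Rightarrow> nat \<Rightarrow> ((nat \<Rightarrow> int) \<Rightarrow> 'a::ring_1) \<Rightarrow> int multiset \<Rightarrow> 'a set" where
  "orbit_block e \<eta> n idem \<alpha> =
     {\<Sum>\<beta>\<in>shift_orbit e \<eta> \<alpha>. x \<beta> | x. \<forall>\<beta>\<in>shift_orbit e \<eta> \<alpha>. x \<beta> \<in> block e n idem \<beta>}"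

definition fixed_orbit_block ::
    "nat \<Rightarrow> nat \<Rightarrow> nat \<Rightarrow> ('a \<Rightarrow> 'a) \<Rightarrow> ((nat \<Rightarrow> int) \<Rightarrow> 'a::ring_1) \<Rightarrow> int multiset \<Rightarrow> 'a set" where
  "fixed_orbit_block e \<eta> n \<sigma> idem \<alpha> = {x \<in> orbit_block e \<eta> n idem \<alpha>. \<sigma> x = x}"

definition mu :: "nat \<Rightarrow> ('a \<Rightarrow> 'a) \<Rightarrow> 'a::ring_1 \<Rightarrow> 'a" where
  "mu p \<sigma> x = (\<Sum>j<p. (\<sigma> ^^ j) x)"

end

theory Submission
  imports Defs
begin

text \<open>
  Let \<open>E\<close> be the sum of the idempotents \<open>e(i)\<close> over the residue tuples \<open>i\<close> of content \<open>\<alpha>\<close>, so that the block at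
  \<open>\<alpha>\<close> is the corner \<open>E\<H>E\<close>.  The proof rests on two observations.

  First, the cellular structure of \<open>\<H>\<close> restricts to this corner.  Two tableaux of shape \<open>\<lambda>\<close> have residue tuples of
  the same content, namely that of \<open>\<lambda>\<close>; hence the linear map \<open>x \<mapsto> ExE\<close> fixes \<open>c\<^sup>\<lambda>\<^sub>s\<^sub>t\<close> if \<open>\<lambda>\<close> has content \<open>\<alpha>\<close> and kills
  it otherwise.  Applied to the basis and to the multiplication rule of \<open>\<H>\<close>, this map yields those of the
  corner (\<open>cellular_datum_with_corner\<close>).

  Secondly, \<open>\<mu>\<close> is an algebra isomorphism from the corner onto the fixed subalgebra.  Since \<open>\<sigma>\<close> lowers all
  residues by \<open>\<eta>\<close>, it moves \<open>E\<close> through the idempotents of the orbit \<open>[\<alpha>]\<close>, and because this orbit has the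
  maximal size \<open>p\<close> the elements \<open>\<sigma>\<^sup>jE\<close>, \<open>j < p\<close>, are pairwise orthogonal.  The mixed terms \<open>\<sigma>\<^sup>i(x) \<sigma>\<^sup>j(y)\<close> of
  \<open>\<mu>(x) \<mu>(y)\<close> therefore vanish for \<open>x\<close>, \<open>y\<close> in the corner, which leaves \<open>\<mu>(xy)\<close>
  (\<open>mu_mult_on_corner\<close>); compression by \<open>E\<close> recovers \<open>x\<close> from \<open>\<mu>(x)\<close> (\<open>inj_on_mu_corner\<close>); and an element
  \<open>z\<close> of the orbit block fixed by \<open>\<sigma>\<close> is determined by its component \<open>EzE\<close>, the other components being the
  translates of this one, so that \<open>z = \<mu>(EzE)\<close> (\<open>mu_image_corner\<close>).

  A cellular datum can be transported along an algebra isomorphism (\<open>cellular_datum_transport\<close>), which carries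
  the basis elements \<open>c\<^sup>\<lambda>\<^sub>s\<^sub>t\<close> to \<open>\<mu>(c\<^sup>\<lambda>\<^sub>s\<^sub>t)\<close>.  The anti-automorphism obtained is the conjugate of \<open>*\<close> by \<open>\<mu>\<close>.
\<close>

section \<open>Residue tuples and their contents\<close>

text \<open>
  Counting components is the same as forming the multiset of components.  In this form it is evident that
  distinct contents have disjoint sets of tuples, and that changing a tuple entrywise changes its content by an
  image.
\<close>
lemma tuples_of_content_eq:
  assumes "set_mset \<beta> \<subseteq> {0..<int e}"
  shows "tuples_of_content e n \<beta> = {i \<in> residue_tuples e n. image_mset i (mset_set {1..n}) = \<beta>}"
proof -
  have "(\<forall>k\<in>{0..<int e}. card {a \<in> {1..n}. i a = k} = count \<beta> k) \<longleftrightarrow>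
        image_mset i (mset_set {1..n}) = \<beta>" if i: "i \<in> residue_tuples e n" for i
  proof -
    have "card {a \<in> {1..n}. i a = k} = count \<beta> k" if "k \<notin> {0..<int e}" for k
    proof -
      have "{a \<in> {1..n}. i a = k} = {}"
        using i that unfolding residue_tuples_def by (auto simp: PiE_iff)
      moreover have "count \<beta> k = 0"
        using assms that by (meson count_eq_zero_iff subsetD)
      ultimately show ?thesis by (metis card.empty)
    qed
    moreover have "count (image_mset i (mset_set {1..n})) k = card {a \<in> {1..n}. i a = k}" for k
      unfolding count_image_mset' card_eq_sum by (intro sum.cong) auto
    ultimately show ?thesis
      by (metis multiset_eq_iff)
  qed
  then show ?thesis
    unfolding tuples_of_content_def by blast
qed

lemma finite_tuples_of_content: "finite (tuples_of_content e n \<beta>)"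
proof (rule finite_subset)
  show "tuples_of_content e n \<beta> \<subseteq> {1..n} \<rightarrow>\<^sub>E {0..<int e}"
    by (auto simp: tuples_of_content_def residue_tuples_def)
qed (simp add: finite_PiE)

lemma content_eq_image_mset:
  "content e \<kappa> lam = image_mset (res_node e \<kappa>) (mset_set (young_diagram lam))"
proof -
  have "(\<Sum>\<gamma>\<in>Y. {#f \<gamma>#}) = image_mset f (mset_set Y)" for f :: "node \<Rightarrow> int" and Y
    by (induction Y rule: infinite_finite_induct) auto
  then show ?thesis unfolding content_def .
qed

lemma set_mset_content: "e \<ge> 1 \<Longrightarrow> set_mset (content e \<kappa> lam) \<subseteq> {0..<int e}"
  unfolding content_eq_image_mset by (auto simp: res_node_def)

text \<open>
  The residue tuple lists the residues of all nodes of the diagram in the order given by the tableau, so its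
  content depends on the shape only.
\<close>
lemma res_tableau_in_tuples_of_content:
  assumes "e \<ge> 1" "\<tt> \<in> standard_tableaux n lam"
  shows "res_tableau e \<kappa> n lam \<tt> \<in> tuples_of_content e n (content e \<kappa> lam)"
proof -
  let ?Y = "young_diagram lam"
  have bij: "bij_betw (inv_into ?Y \<tt>) {1..n} ?Y"
    using assms(2) by (auto simp: standard_tableaux_def intro: bij_betw_inv_into)
  have "res_tableau e \<kappa> n lam \<tt> \<in> residue_tuples e n"
    using assms(1) by (auto simp: residue_tuples_def res_tableau_def res_node_def split: prod.splits)
  moreover have "image_mset (res_tableau e \<kappa> n lam \<tt>) (mset_set {1..n}) = content e \<kappa> lam"
  proof -
    have "image_mset (res_tableau e \<kappa> n lam \<tt>) (mset_set {1..n}) =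
        image_mset (res_node e \<kappa>) (image_mset (inv_into ?Y \<tt>) (mset_set {1..n}))"
      unfolding multiset.map_comp by (rule image_mset_cong) (simp add: res_tableau_def)
    also have "image_mset (inv_into ?Y \<tt>) (mset_set {1..n}) = mset_set ?Y"
      using bij by (simp add: bij_betw_def image_mset_mset_set)
    finally show ?thesis by (simp add: content_eq_image_mset)
  qed
  ultimately show ?thesis
    by (simp add: tuples_of_content_eq[OF set_mset_content[OF assms(1)]])
qed

lemma set_mset_shift: "e \<ge> 1 \<Longrightarrow> set_mset (shift e \<eta> \<beta>) \<subseteq> {0..<int e}"
  unfolding shift_def by auto

lemma set_mset_shift_funpow:
  assumes "e \<ge> 1" "set_mset \<beta> \<subseteq> {0..<int e}"
  shows "set_mset ((shift e \<eta> ^^ j) \<beta>) \<subseteq> {0..<int e}"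
proof (cases j)
  case (Suc k)
  then show ?thesis using set_mset_shift[OF assms(1)] by simp
qed (use assms(2) in simp)

lemma shift_funpow:
  assumes "set_mset \<beta> \<subseteq> {0..<int e}"
  shows "(shift e \<eta> ^^ j) \<beta> = image_mset (\<lambda>i. (i + int (j * \<eta>)) mod int e) \<beta>"
proof (induction j)
  case 0
  have "image_mset (\<lambda>i. i mod int e) \<beta> = image_mset (\<lambda>i. i) \<beta>"
    by (rule image_mset_cong) (use assms in auto)
  then show ?case by simp
next
  case (Suc j)
  then show ?case
    by (simp add: shift_def multiset.map_comp comp_def mod_simps algebra_simps)
qed

lemma shift_period:
  assumes "set_mset \<beta> \<subseteq> {0..<int (\<eta> * p)}"
  shows "(shift (\<eta> * p) \<eta> ^^ p) \<beta> = \<beta>"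
proof -
  have "image_mset (\<lambda>i. (i + int (p * \<eta>)) mod int (\<eta> * p)) \<beta> = image_mset (\<lambda>i. i) \<beta>"
    by (rule image_mset_cong) (use assms in \<open>auto simp: mult.commute\<close>)
  then show ?thesis by (simp only: shift_funpow[OF assms]) simp
qed

text \<open>
  Subtracting \<open>\<eta>\<close> undoes the shift of contents: this is what makes \<open>\<sigma>\<close> act on content idempotents as the
  inverse of the shift.
\<close>
lemma bij_betw_tuple_minus:
  assumes "e \<ge> 1" and \<beta>: "set_mset \<beta> \<subseteq> {0..<int e}"
  shows "bij_betw (tuple_minus e \<eta> n) (tuples_of_content e n (shift e \<eta> \<beta>)) (tuples_of_content e n \<beta>)"
proof -
  define plus where "plus = (\<lambda>i :: nat \<Rightarrow> int. \<lambda>a\<in>{1..n}. (i a + int \<eta>) mod int e)"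
  have mod_sub: "((k + int \<eta>) mod int e - int \<eta>) mod int e = k"
    "((k - int \<eta>) mod int e + int \<eta>) mod int e = k" if "k \<in> {0..<int e}" for k
    using that by (simp_all add: mod_diff_left_eq mod_add_left_eq)
  have undo: "tuple_minus e \<eta> n (plus i) = i" "plus (tuple_minus e \<eta> n i) = i"
    if "i \<in> residue_tuples e n" for i
    using that mod_sub
    by (auto simp: tuple_minus_def plus_def residue_tuples_def PiE_iff extensional_def fun_eq_iff)
  have res: "tuple_minus e \<eta> n i \<in> residue_tuples e n" "plus i \<in> residue_tuples e n" for i
    using assms(1) by (auto simp: tuple_minus_def plus_def residue_tuples_def)
  have minus_mset: "image_mset (tuple_minus e \<eta> n i) (mset_set {1..n}) = \<beta>"
    if "image_mset i (mset_set {1..n}) = shift e \<eta> \<beta>" for i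
  proof -
    have "image_mset (tuple_minus e \<eta> n i) (mset_set {1..n}) =
        image_mset (\<lambda>k. (k - int \<eta>) mod int e) (image_mset i (mset_set {1..n}))"
      unfolding multiset.map_comp by (rule image_mset_cong) (simp add: tuple_minus_def)
    also have "\<dots> = image_mset (\<lambda>k. ((k + int \<eta>) mod int e - int \<eta>) mod int e) \<beta>"
      unfolding that by (simp add: shift_def multiset.map_comp comp_def)
    also have "\<dots> = image_mset (\<lambda>k. k) \<beta>"
      by (rule image_mset_cong) (use \<beta> mod_sub in auto)
    finally show ?thesis by simp
  qed
  have plus_mset: "image_mset (plus i) (mset_set {1..n}) = shift e \<eta> \<beta>"
    if "image_mset i (mset_set {1..n}) = \<beta>" for i
    unfolding that[symmetric] shift_def multiset.map_comp
    by (rule image_mset_cong) (simp add: plus_def)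
  show ?thesis
    unfolding tuples_of_content_eq[OF \<beta>] tuples_of_content_eq[OF set_mset_shift[OF assms(1)]]
    by (rule bij_betw_byWitness[where f' = plus])
      (use undo res minus_mset plus_mset in auto)
qed

text \<open>
  A periodic orbit, listed against the direction of \<open>f\<close>: \<open>j\<close> further steps lead from the \<open>j\<close>-th entry to \<open>x\<close>.  The
  powers of \<open>\<sigma>\<close> visit the contents of an orbit of the shift in this order.
\<close>
lemma funpow_orbit_backwards:
  fixes f :: "'x \<Rightarrow> 'x"
  assumes "0 < p" "(f ^^ p) x = x"
  shows "{(f ^^ k) x | k. True} = (\<lambda>j. (f ^^ (p - j)) x) ` {..<p}"
proof -
  have "\<exists>j<p. (f ^^ k) x = (f ^^ (p - j)) x" for k
  proof (cases "k mod p = 0")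
    case True
    then have "(f ^^ k) x = (f ^^ (p - 0)) x"
      using funpow_mod_eq[OF assms(2), of k] assms(2) by simp
    then show ?thesis using assms(1) by blast
  next
    case False
    then have "p - k mod p < p" "p - (p - k mod p) = k mod p"
      using assms(1) by (auto intro: diff_le_self)
    then show ?thesis using funpow_mod_eq[OF assms(2), of k] by metis
  qed
  then show ?thesis by blast
qed

section \<open>Corners and transport of cellular data\<close>

definition corner :: "'a::ring_1 \<Rightarrow> 'a set" where
  "corner E = {E * x * E | x. True}"

lemma corner_iff:
  assumes "E * E = E"
  shows "x \<in> corner E \<longleftrightarrow> E * x * E = x"
  unfolding corner_def using assms by (auto simp: mult.assoc) (metis mult.assoc)+

lemma corner_absorb:
  assumes "E * E = E" "x \<in> corner E"
  shows "E * x = x" "x * E = x"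
  using assms unfolding corner_def by (auto simp: mult.assoc) (simp add: mult.assoc[symmetric])

context assoc_algebra
begin

lemma module_hom_compress: "module_hom scale scale (\<lambda>x. E * x * E)"
  by unfold_locales (simp_all add: distrib_left distrib_right scale_mult_left scale_mult_right
      scale_right_distrib scale_left_distrib)

lemma subspace_corner: "subspace (corner E)"
proof -
  interpret h: module_hom scale scale "\<lambda>x. E * x * E" by (rule module_hom_compress)
  have "corner E = range (\<lambda>x. E * x * E)" by (auto simp: corner_def)
  then show ?thesis using h.subspace_image[OF subspace_UNIV] by metis
qed

text \<open>
  The compression \<open>x \<mapsto> E x E\<close> is linear with image the corner, and sends each basis element to itself or to zero.
  It therefore maps the basis, up to zero, onto the subset of survivors, and every span of basis elements to the
  span of the survivors among them.  For \<open>a\<close> in the corner it fixes both sides of the multiplication rule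
  except for the error term, which stays in the span of the larger cells.
\<close>
lemma cellular_datum_with_corner:
  assumes cell: "cellular_datum_with UNIV \<Lambda> leq Tab c star"
    and idem: "E * E = E" and star: "star E = E" and sub: "\<Lambda>' \<subseteq> \<Lambda>"
    and inside: "\<And>lam \<ss> \<tt>. lam \<in> \<Lambda>' \<Longrightarrow> \<ss> \<in> Tab lam \<Longrightarrow> \<tt> \<in> Tab lam \<Longrightarrow> E * c lam \<ss> \<tt> * E = c lam \<ss> \<tt>"
    and outside: "\<And>lam \<ss> \<tt>. lam \<in> \<Lambda> - \<Lambda>' \<Longrightarrow> \<ss> \<in> Tab lam \<Longrightarrow> \<tt> \<in> Tab lam \<Longrightarrow> E * c lam \<ss> \<tt> * E = 0"
  shows "cellular_datum_with (corner E) \<Lambda>' (leq \<inter> \<Lambda>' \<times> \<Lambda>') Tab c star"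
proof -
  interpret h: module_hom scale scale "\<lambda>x. E * x * E" by (rule module_hom_compress)
  let ?h = "\<lambda>x. E * x * E"
  define C where "C = {c lam \<ss> \<tt> | lam \<ss> \<tt>. lam \<in> \<Lambda> \<and> \<ss> \<in> Tab lam \<and> \<tt> \<in> Tab lam}"
  define C' where "C' = {c lam \<ss> \<tt> | lam \<ss> \<tt>. lam \<in> \<Lambda>' \<and> \<ss> \<in> Tab lam \<and> \<tt> \<in> Tab lam}"
  have fd: "fd_algebra_on UNIV" and fin: "finite \<Lambda>" and po: "partial_order_on \<Lambda> leq"
    and inj: "inj_on (\<lambda>(lam, \<ss>, \<tt>). c lam \<ss> \<tt>) (SIGMA lam:\<Lambda>. Tab lam \<times> Tab lam)"
    and indep: "independent C" and span: "span C = UNIV"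
    and anti: "anti_automorphism_on UNIV star"
    and st: "\<forall>lam\<in>\<Lambda>. \<forall>\<ss>\<in>Tab lam. \<forall>\<tt>\<in>Tab lam. star (c lam \<ss> \<tt>) = c lam \<tt> \<ss>"
    and act: "\<forall>lam\<in>\<Lambda>. \<forall>\<tt>\<in>Tab lam. \<forall>a\<in>UNIV. \<exists>\<rho>. \<forall>\<ss>\<in>Tab lam.
      c lam \<ss> \<tt> * a - (\<Sum>\<vv>\<in>Tab lam. \<rho> \<vv> *s c lam \<ss> \<vv>)
        \<in> span {c \<nu> \<aa> \<bb> | \<nu> \<aa> \<bb>. \<nu> \<in> \<Lambda> \<and> (lam, \<nu>) \<in> leq \<and> \<nu> \<noteq> lam \<and> \<aa> \<in> Tab \<nu> \<and> \<bb> \<in> Tab \<nu>}"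
    using cell unfolding cellular_datum_with_def C_def by simp_all
  have range: "corner E = range ?h" by (auto simp: corner_def)
  have C'C: "C' \<subseteq> C" using sub by (auto simp: C_def C'_def)
  have C'corner: "C' \<subseteq> corner E"
    using inside by (auto simp: C'_def corner_iff[OF idem])
  have hC: "?h ` C \<subseteq> insert 0 C'"
  proof
    fix z assume "z \<in> ?h ` C"
    then obtain lam s t where z: "z = ?h (c lam s t)" "lam \<in> \<Lambda>" "s \<in> Tab lam" "t \<in> Tab lam"
      by (auto simp: C_def)
    then show "z \<in> insert 0 C'"
      using inside[of lam s t] outside[of lam s t] by (cases "lam \<in> \<Lambda>'") (auto simp: C'_def)
  qed
  have spanC': "span C' = corner E"
  proof
    show "span C' \<subseteq> corner E"
      by (rule span_minimal[OF C'corner subspace_corner])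
    have "corner E = span (?h ` C)"
      using h.span_image[of C] span range by simp
    also have "\<dots> \<subseteq> span C'"
      using span_mono[OF hC] by simp
    finally show "corner E \<subseteq> span C'" .
  qed
  have fd': "fd_algebra_on (corner E)"
  proof -
    obtain B where "finite B" "span B = UNIV"
      using fd unfolding fd_algebra_on_def by auto
    then have "finite (?h ` B)" "?h ` B \<subseteq> corner E" "span (?h ` B) = corner E"
      using h.span_image[of B] range by auto
    moreover have "x * y \<in> corner E" if "x \<in> corner E" "y \<in> corner E" for x y
      using corner_absorb[OF idem that(1)] corner_absorb[OF idem that(2)]
      by (metis corner_iff[OF idem] mult.assoc)
    moreover have "E \<in> corner E" by (simp add: corner_iff idem)
    ultimately show ?thesis
      unfolding fd_algebra_on_def using subspace_corner corner_absorb[OF idem] by metis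
  qed
  have po': "partial_order_on \<Lambda>' (leq \<inter> \<Lambda>' \<times> \<Lambda>')"
    using po sub unfolding partial_order_on_def preorder_on_def refl_on_def trans_def antisym_def
    by blast
  have anti': "anti_automorphism_on (corner E) star"
  proof -
    have star_h: "star (?h x) = ?h (star x)" for x
      using anti star unfolding anti_automorphism_on_def by (simp add: mult.assoc)
    have bij: "bij star" using anti by (simp add: anti_automorphism_on_def)
    have "star ` corner E = ?h ` (star ` UNIV)"
      unfolding range image_image star_h ..
    then have "star ` corner E = corner E"
      using bij range by (simp add: bij_is_surj)
    then have "bij_betw star (corner E) (corner E)"
      using bij by (auto simp: bij_betw_def intro: inj_on_subset)
    then show ?thesis using anti unfolding anti_automorphism_on_def by auto
  qed
  have mult: "\<exists>\<rho>. \<forall>\<ss>\<in>Tab lam. c lam \<ss> \<tt> * a - (\<Sum>\<vv>\<in>Tab lam. \<rho> \<vv> *s c lam \<ss> \<vv>)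
      \<in> span {c \<nu> \<aa> \<bb> | \<nu> \<aa> \<bb>. \<nu> \<in> \<Lambda>' \<and> (lam, \<nu>) \<in> leq \<inter> \<Lambda>' \<times> \<Lambda>' \<and> \<nu> \<noteq> lam \<and> \<aa> \<in> Tab \<nu> \<and> \<bb> \<in> Tab \<nu>}"
    (is "\<exists>\<rho>. \<forall>\<ss>\<in>_. _ \<in> span ?D'")
    if lam: "lam \<in> \<Lambda>'" and t: "\<tt> \<in> Tab lam" and a: "a \<in> corner E" for lam \<tt> a
  proof -
    let ?D = "{c \<nu> \<aa> \<bb> | \<nu> \<aa> \<bb>. \<nu> \<in> \<Lambda> \<and> (lam, \<nu>) \<in> leq \<and> \<nu> \<noteq> lam \<and> \<aa> \<in> Tab \<nu> \<and> \<bb> \<in> Tab \<nu>}"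
    have lam': "lam \<in> \<Lambda>" using lam sub by blast
    obtain \<rho> where \<rho>: "\<forall>\<ss>\<in>Tab lam. c lam \<ss> \<tt> * a - (\<Sum>\<vv>\<in>Tab lam. \<rho> \<vv> *s c lam \<ss> \<vv>) \<in> span ?D"
      using bspec[OF bspec[OF bspec[OF act lam'] t] UNIV_I] by blast
    have hD: "?h ` ?D \<subseteq> insert 0 ?D'"
    proof
      fix z assume "z \<in> ?h ` ?D"
      then obtain \<nu> u v where z: "z = ?h (c \<nu> u v)" "\<nu> \<in> \<Lambda>" "(lam, \<nu>) \<in> leq" "\<nu> \<noteq> lam"
        "u \<in> Tab \<nu>" "v \<in> Tab \<nu>"
        by auto
      then show "z \<in> insert 0 ?D'"
        using inside[of \<nu> u v] outside[of \<nu> u v] lam by (cases "\<nu> \<in> \<Lambda>'") auto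
    qed
    have "c lam s \<tt> * a - (\<Sum>\<vv>\<in>Tab lam. \<rho> \<vv> *s c lam s \<vv>) \<in> span ?D'" if s: "s \<in> Tab lam" for s
    proof -
      have "?h (c lam s \<tt> * a) = c lam s \<tt> * a"
        using corner_absorb[OF idem, of "c lam s \<tt>"] corner_absorb[OF idem a] inside[OF lam s t]
        by (metis corner_iff[OF idem] mult.assoc)
      moreover have "?h (\<Sum>\<vv>\<in>Tab lam. \<rho> \<vv> *s c lam s \<vv>) = (\<Sum>\<vv>\<in>Tab lam. \<rho> \<vv> *s c lam s \<vv>)"
        unfolding h.sum h.scale by (rule sum.cong) (simp_all add: inside[OF lam s])
      ultimately have "c lam s \<tt> * a - (\<Sum>\<vv>\<in>Tab lam. \<rho> \<vv> *s c lam s \<vv>) =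
          ?h (c lam s \<tt> * a - (\<Sum>\<vv>\<in>Tab lam. \<rho> \<vv> *s c lam s \<vv>))"
        by (metis h.diff)
      also have "\<dots> \<in> ?h ` span ?D" using \<rho> s by blast
      also have "?h ` span ?D = span (?h ` ?D)" by (rule h.span_image[symmetric])
      also have "\<dots> \<subseteq> span ?D'" using span_mono[OF hD] by simp
      finally show ?thesis .
    qed
    then show ?thesis by blast
  qed
  have "finite \<Lambda>'" using fin sub finite_subset by blast
  moreover have "inj_on (\<lambda>(lam, \<ss>, \<tt>). c lam \<ss> \<tt>) (SIGMA lam:\<Lambda>'. Tab lam \<times> Tab lam)"
    by (rule inj_on_subset[OF inj]) (use sub in auto)
  moreover have "independent C'"
    using indep C'C independent_mono by blast
  moreover have "\<forall>lam\<in>\<Lambda>'. \<forall>\<ss>\<in>Tab lam. \<forall>\<tt>\<in>Tab lam. star (c lam \<ss> \<tt>) = c lam \<tt> \<ss>"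
    using st sub by blast
  ultimately show ?thesis
    unfolding cellular_datum_with_def C'_def[symmetric]
    using fd' po' spanC' anti' mult by blast
qed

text \<open>
  The isomorphism is given as the restriction of a linear map of the whole algebra that is injective and
  multiplicative on \<open>B\<close> alone; this is how \<open>\<mu>\<close> arises, which is in general not multiplicative on all of the algebra.
\<close>
lemma cellular_datum_transport:
  assumes cell: "cellular_datum_with B \<Lambda> leq Tab c star"
    and hom: "module_hom scale scale \<phi>"
    and inj: "inj_on \<phi> B"
    and mult: "\<And>x y. x \<in> B \<Longrightarrow> y \<in> B \<Longrightarrow> \<phi> (x * y) = \<phi> x * \<phi> y"
  shows "cellular_datum (\<phi> ` B) \<Lambda> leq Tab (\<lambda>lam \<ss> \<tt>. \<phi> (c lam \<ss> \<tt>))"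
proof -
  interpret h: module_hom scale scale \<phi> by (rule hom)
  define C where "C = {c lam \<ss> \<tt> | lam \<ss> \<tt>. lam \<in> \<Lambda> \<and> \<ss> \<in> Tab lam \<and> \<tt> \<in> Tab lam}"
  define \<pi> where "\<pi> = inv_into B \<phi>"
  have fd: "fd_algebra_on B" and fin: "finite \<Lambda>" and po: "partial_order_on \<Lambda> leq"
    and injc: "inj_on (\<lambda>(lam, \<ss>, \<tt>). c lam \<ss> \<tt>) (SIGMA lam:\<Lambda>. Tab lam \<times> Tab lam)"
    and indep: "independent C" and span: "span C = B"
    and anti: "anti_automorphism_on B star"
    and st: "\<forall>lam\<in>\<Lambda>. \<forall>\<ss>\<in>Tab lam. \<forall>\<tt>\<in>Tab lam. star (c lam \<ss> \<tt>) = c lam \<tt> \<ss>"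
    and act: "\<forall>lam\<in>\<Lambda>. \<forall>\<tt>\<in>Tab lam. \<forall>a\<in>B. \<exists>\<rho>. \<forall>\<ss>\<in>Tab lam.
      c lam \<ss> \<tt> * a - (\<Sum>\<vv>\<in>Tab lam. \<rho> \<vv> *s c lam \<ss> \<vv>)
        \<in> span {c \<nu> \<aa> \<bb> | \<nu> \<aa> \<bb>. \<nu> \<in> \<Lambda> \<and> (lam, \<nu>) \<in> leq \<and> \<nu> \<noteq> lam \<and> \<aa> \<in> Tab \<nu> \<and> \<bb> \<in> Tab \<nu>}"
    using cell unfolding cellular_datum_with_def C_def by simp_all
  have CB: "C \<subseteq> B" using span span_superset by blast
  then have cB: "c lam s t \<in> B" if "lam \<in> \<Lambda>" "s \<in> Tab lam" "t \<in> Tab lam" for lam s t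
    using that by (auto simp: C_def)
  have \<pi>: "\<pi> (\<phi> x) = x" if "x \<in> B" for x
    using inj that by (simp add: \<pi>_def)
  have imC: "{\<phi> (c lam \<ss> \<tt>) | lam \<ss> \<tt>. lam \<in> \<Lambda> \<and> \<ss> \<in> Tab lam \<and> \<tt> \<in> Tab lam} = \<phi> ` C"
    by (auto simp: C_def)
  have subB: "subspace B" and multB: "\<And>x y. x \<in> B \<Longrightarrow> y \<in> B \<Longrightarrow> x * y \<in> B"
    using fd by (auto simp: fd_algebra_on_def)
  have addB: "\<And>x y. x \<in> B \<Longrightarrow> y \<in> B \<Longrightarrow> x + y \<in> B" and scaleB: "\<And>k x. x \<in> B \<Longrightarrow> k *s x \<in> B"
    using subB by (auto simp: subspace_def)
  have fd': "fd_algebra_on (\<phi> ` B)"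
  proof -
    obtain u where u: "u \<in> B" "\<forall>x\<in>B. u * x = x \<and> x * u = x"
      using fd by (auto simp: fd_algebra_on_def)
    have "\<phi> u \<in> \<phi> ` B \<and> (\<forall>x\<in>\<phi> ` B. \<phi> u * x = x \<and> x * \<phi> u = x)"
      using u mult by (metis (no_types, lifting) image_iff)
    moreover obtain G where G: "finite G" "G \<subseteq> B" "span G = B"
      using fd by (auto simp: fd_algebra_on_def)
    then have "finite (\<phi> ` G)" "\<phi> ` G \<subseteq> \<phi> ` B" "span (\<phi> ` G) = \<phi> ` B"
      using h.span_image[of G] by auto
    moreover have "x * y \<in> \<phi> ` B" if "x \<in> \<phi> ` B" "y \<in> \<phi> ` B" for x y
      using that mult multB by (metis (no_types, lifting) image_iff)
    moreover have "subspace (\<phi> ` B)" by (rule h.subspace_image[OF subB])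
    ultimately show ?thesis unfolding fd_algebra_on_def by metis
  qed
  have star_bij: "bij_betw star B B" and starB: "\<And>x. x \<in> B \<Longrightarrow> star x \<in> B"
    using anti by (auto simp: anti_automorphism_on_def bij_betw_def)
  have anti': "anti_automorphism_on (\<phi> ` B) (\<phi> \<circ> star \<circ> \<pi>)"
  proof -
    have bij: "bij_betw \<phi> B (\<phi> ` B)" by (simp add: bij_betw_def inj)
    have "bij_betw (\<phi> \<circ> star \<circ> \<pi>) (\<phi> ` B) (\<phi> ` B)"
      using bij_betw_trans[OF bij_betw_trans[OF bij_betw_inv_into[OF bij] star_bij] bij]
      by (simp add: \<pi>_def o_assoc)
    moreover have "(\<phi> \<circ> star \<circ> \<pi>) (\<phi> x + \<phi> y) = (\<phi> \<circ> star \<circ> \<pi>) (\<phi> x) + (\<phi> \<circ> star \<circ> \<pi>) (\<phi> y)"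
      if "x \<in> B" "y \<in> B" for x y
      using that anti addB[OF that] by (simp add: \<pi> anti_automorphism_on_def flip: h.add)
    moreover have "(\<phi> \<circ> star \<circ> \<pi>) (k *s \<phi> x) = k *s (\<phi> \<circ> star \<circ> \<pi>) (\<phi> x)"
      if "x \<in> B" for k x
      using that anti scaleB[OF that] by (simp add: \<pi> anti_automorphism_on_def flip: h.scale)
    moreover have "(\<phi> \<circ> star \<circ> \<pi>) (\<phi> x * \<phi> y) = (\<phi> \<circ> star \<circ> \<pi>) (\<phi> y) * (\<phi> \<circ> star \<circ> \<pi>) (\<phi> x)"
      if "x \<in> B" "y \<in> B" for x y
      using that anti multB[OF that] starB by (simp add: \<pi> anti_automorphism_on_def flip: mult)
    ultimately show ?thesis
      unfolding anti_automorphism_on_def by (simp only: ball_simps) blast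
  qed
  have mult': "\<exists>\<rho>. \<forall>\<ss>\<in>Tab lam. \<phi> (c lam \<ss> \<tt>) * z - (\<Sum>\<vv>\<in>Tab lam. \<rho> \<vv> *s \<phi> (c lam \<ss> \<vv>))
      \<in> span {\<phi> (c \<nu> \<aa> \<bb>) | \<nu> \<aa> \<bb>. \<nu> \<in> \<Lambda> \<and> (lam, \<nu>) \<in> leq \<and> \<nu> \<noteq> lam \<and> \<aa> \<in> Tab \<nu> \<and> \<bb> \<in> Tab \<nu>}"
    (is "\<exists>\<rho>. \<forall>\<ss>\<in>_. _ \<in> span ?D'")
    if lam: "lam \<in> \<Lambda>" and t: "\<tt> \<in> Tab lam" and z: "z \<in> \<phi> ` B" for lam \<tt> z
  proof -
    let ?D = "{c \<nu> \<aa> \<bb> | \<nu> \<aa> \<bb>. \<nu> \<in> \<Lambda> \<and> (lam, \<nu>) \<in> leq \<and> \<nu> \<noteq> lam \<and> \<aa> \<in> Tab \<nu> \<and> \<bb> \<in> Tab \<nu>}"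
    obtain a where a: "a \<in> B" "z = \<phi> a" using z by blast
    obtain \<rho> where \<rho>: "\<forall>\<ss>\<in>Tab lam. c lam \<ss> \<tt> * a - (\<Sum>\<vv>\<in>Tab lam. \<rho> \<vv> *s c lam \<ss> \<vv>) \<in> span ?D"
      using bspec[OF bspec[OF bspec[OF act lam] t] a(1)] by blast
    have D': "?D' = \<phi> ` ?D" by blast
    have "\<phi> (c lam s \<tt>) * z - (\<Sum>\<vv>\<in>Tab lam. \<rho> \<vv> *s \<phi> (c lam s \<vv>)) \<in> span ?D'" if s: "s \<in> Tab lam" for s
    proof -
      have "\<phi> (c lam s \<tt>) * z - (\<Sum>\<vv>\<in>Tab lam. \<rho> \<vv> *s \<phi> (c lam s \<vv>)) =
          \<phi> (c lam s \<tt> * a - (\<Sum>\<vv>\<in>Tab lam. \<rho> \<vv> *s c lam s \<vv>))"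
        by (simp add: h.diff h.sum h.scale a mult cB[OF lam s t])
      also have "\<dots> \<in> \<phi> ` span ?D" using \<rho> s by blast
      finally show ?thesis unfolding D' h.span_image .
    qed
    then show ?thesis by blast
  qed
  have "inj_on (\<lambda>(lam, \<ss>, \<tt>). \<phi> (c lam \<ss> \<tt>)) (SIGMA lam:\<Lambda>. Tab lam \<times> Tab lam)"
  proof -
    have "(\<lambda>(lam, \<ss>, \<tt>). c lam \<ss> \<tt>) ` (SIGMA lam:\<Lambda>. Tab lam \<times> Tab lam) \<subseteq> B"
      using cB by auto
    from comp_inj_on[OF injc inj_on_subset[OF inj this]]
    show ?thesis by (simp add: comp_def split_def)
  qed
  moreover have "independent (\<phi> ` C)"
    by (rule h.independent_injective_image[OF indep]) (simp add: span inj)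
  moreover have "span (\<phi> ` C) = \<phi> ` B"
    by (simp add: h.span_image span)
  moreover have "\<forall>lam\<in>\<Lambda>. \<forall>\<ss>\<in>Tab lam. \<forall>\<tt>\<in>Tab lam. (\<phi> \<circ> star \<circ> \<pi>) (\<phi> (c lam \<ss> \<tt>)) = \<phi> (c lam \<tt> \<ss>)"
    using st by (simp add: \<pi> cB)
  ultimately have "cellular_datum_with (\<phi> ` B) \<Lambda> leq Tab (\<lambda>lam \<ss> \<tt>. \<phi> (c lam \<ss> \<tt>)) (\<phi> \<circ> star \<circ> \<pi>)"
    unfolding cellular_datum_with_def imC using fd' fin po anti' mult' by blast
  then show ?thesis unfolding cellular_datum_def by blast
qed

section \<open>Averaging over a cyclic group with orthogonal translates\<close>

lemma automorphism_funpow: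
  assumes "algebra_automorphism \<sigma>"
  shows "algebra_automorphism (\<sigma> ^^ j)"
proof (induction j)
  case 0
  then show ?case by (simp add: algebra_automorphism_def bij_betw_def)
next
  case (Suc j)
  then show ?case using assms by (auto simp: algebra_automorphism_def intro: bij_comp[unfolded comp_def])
qed

lemma module_hom_automorphism:
  assumes "algebra_automorphism \<sigma>"
  shows "module_hom scale scale \<sigma>"
  using assms by unfold_locales (simp_all add: algebra_automorphism_def scale_right_distrib scale_left_distrib)

lemma module_hom_mu:
  assumes "algebra_automorphism \<sigma>"
  shows "module_hom scale scale (mu p \<sigma>)"
proof -
  have "algebra_automorphism (\<sigma> ^^ j)" for j by (rule automorphism_funpow[OF assms])
  then show ?thesis
    by unfold_locales
      (simp_all add: algebra_automorphism_def mu_def scale_right_distrib scale_left_distrib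
        sum.distrib scale_sum_right)
qed

text \<open>
  Applying \<open>\<sigma>\<close> moves every summand to the next one, and the last to the first since \<open>\<sigma>\<^sup>p\<close> is the identity.
\<close>
lemma mu_fixed:
  assumes \<sigma>: "algebra_automorphism \<sigma>" and period: "\<sigma> ^^ p = id"
  shows "\<sigma> (mu p \<sigma> x) = mu p \<sigma> x"
proof -
  interpret s: module_hom scale scale \<sigma> by (rule module_hom_automorphism[OF \<sigma>])
  \<comment> \<open>With the extra summand \<open>x\<close> both sides become the sum over \<open>j \<le> p\<close>, split at either end.\<close>
  have "\<sigma> (mu p \<sigma> x) + x = (\<Sum>j<p. (\<sigma> ^^ Suc j) x) + (\<sigma> ^^ 0) x"
    by (simp add: mu_def s.sum)
  also have "\<dots> = (\<Sum>j<Suc p. (\<sigma> ^^ j) x)"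
    by (simp only: sum.lessThan_Suc_shift add.commute)
  also have "\<dots> = mu p \<sigma> x + x"
    by (simp add: mu_def period)
  finally show ?thesis by simp
qed

context
  fixes \<sigma> :: "'a \<Rightarrow> 'a" and p :: nat and E :: 'a
  assumes \<sigma>: "algebra_automorphism \<sigma>" and p: "0 < p"
    and orth: "\<And>i j. i < p \<Longrightarrow> j < p \<Longrightarrow> (\<sigma> ^^ i) E * (\<sigma> ^^ j) E = (if i = j then (\<sigma> ^^ i) E else 0)"
begin

private lemma funpow_mult: "(\<sigma> ^^ j) (x * y) = (\<sigma> ^^ j) x * (\<sigma> ^^ j) y"
  using automorphism_funpow[OF \<sigma>, of j] by (simp add: algebra_automorphism_def)

private lemma funpow_corner:
  assumes "x \<in> corner E"
  shows "(\<sigma> ^^ j) x \<in> corner ((\<sigma> ^^ j) E)"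
  using assms by (auto simp: corner_def funpow_mult)

private lemma corners_orthogonal:
  assumes "i < p" "j < p" "i \<noteq> j" "x \<in> corner ((\<sigma> ^^ i) E)" "y \<in> corner ((\<sigma> ^^ j) E)"
  shows "x * y = 0"
proof -
  obtain u v where "x = (\<sigma> ^^ i) E * u * (\<sigma> ^^ i) E" "y = (\<sigma> ^^ j) E * v * (\<sigma> ^^ j) E"
    using assms(4,5) by (auto simp: corner_def)
  then have "x * y = (\<sigma> ^^ i) E * u * ((\<sigma> ^^ i) E * (\<sigma> ^^ j) E) * v * (\<sigma> ^^ j) E"
    by (simp add: mult.assoc)
  then show ?thesis using orth[OF assms(1,2)] assms(3) by simp
qed

text \<open>
  In the double sum \<open>\<mu>(x) \<mu>(y)\<close> the term with indices \<open>i\<close>, \<open>j\<close> contains the factor \<open>\<sigma>\<^sup>iE \<sigma>\<^sup>jE\<close>, so only the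
  diagonal survives.
\<close>
lemma mu_mult_on_corner:
  assumes x: "x \<in> corner E" and y: "y \<in> corner E"
  shows "mu p \<sigma> (x * y) = mu p \<sigma> x * mu p \<sigma> y"
proof -
  have "mu p \<sigma> x * mu p \<sigma> y = (\<Sum>i<p. \<Sum>j<p. (\<sigma> ^^ i) x * (\<sigma> ^^ j) y)"
    by (simp add: mu_def sum_product)
  also have "\<dots> = (\<Sum>i<p. \<Sum>j<p. if i = j then (\<sigma> ^^ i) (x * y) else 0)"
    by (intro sum.cong refl)
      (auto simp: funpow_mult corners_orthogonal[OF _ _ _ funpow_corner[OF x] funpow_corner[OF y]])
  also have "\<dots> = mu p \<sigma> (x * y)" by (simp add: mu_def)
  finally show ?thesis by simp
qed

text \<open>
  Orthogonality makes the sum of the corners direct: compression by the \<open>i\<close>-th translate of \<open>E\<close> is the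
  projection to the \<open>i\<close>-th summand.
\<close>
private lemma compress_sum:
  assumes x: "\<And>j. j < p \<Longrightarrow> x j \<in> corner ((\<sigma> ^^ j) E)" and i: "i < p"
  shows "(\<sigma> ^^ i) E * (\<Sum>j<p. x j) * (\<sigma> ^^ i) E = x i"
proof -
  let ?E = "(\<sigma> ^^ i) E"
  have idem_i: "?E * ?E = ?E" using orth[OF i i] by simp
  then have E: "?E \<in> corner ?E" by (simp add: corner_iff)
  have "?E * (\<Sum>j<p. x j) = (\<Sum>j<p. if i = j then ?E * x j else 0)"
    unfolding sum_distrib_left
    by (intro sum.cong refl) (auto simp: corners_orthogonal[OF i _ _ E x])
  also have "\<dots> = ?E * x i" using i by simp
  finally show ?thesis
    using corner_absorb[OF idem_i x[OF i]] by simp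
qed

lemma inj_on_mu_corner: "inj_on (mu p \<sigma>) (corner E)"
proof (rule inj_on_inverseI)
  fix x assume "x \<in> corner E"
  then show "E * mu p \<sigma> x * E = x"
    using compress_sum[of "\<lambda>j. (\<sigma> ^^ j) x" 0] p by (simp add: mu_def funpow_corner)
qed

text \<open>
  If \<open>z\<close> is fixed, applying \<open>\<sigma>\<^sup>j\<close> to the component \<open>E z E\<close> gives the component of \<open>z\<close> in the \<open>j\<close>-th corner, and
  summing these gives \<open>z = \<mu>(E z E)\<close>.
\<close>
lemma mu_image_corner:
  assumes period: "\<sigma> ^^ p = id"
  shows "mu p \<sigma> ` corner E =
    {z. (\<exists>x. z = (\<Sum>j<p. x j) \<and> (\<forall>j<p. x j \<in> corner ((\<sigma> ^^ j) E))) \<and> \<sigma> z = z}" (is "_ = ?R")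
proof
  show "mu p \<sigma> ` corner E \<subseteq> ?R"
  proof safe
    fix x assume x: "x \<in> corner E"
    show "\<exists>w. mu p \<sigma> x = (\<Sum>j<p. w j) \<and> (\<forall>j<p. w j \<in> corner ((\<sigma> ^^ j) E))"
      by (rule exI[of _ "\<lambda>j. (\<sigma> ^^ j) x"]) (simp add: mu_def funpow_corner[OF x])
    show "\<sigma> (mu p \<sigma> x) = mu p \<sigma> x" by (rule mu_fixed[OF \<sigma> period])
  qed
  show "?R \<subseteq> mu p \<sigma> ` corner E"
  proof safe
    fix x :: "nat \<Rightarrow> 'a"
    let ?z = "\<Sum>j<p. x j"
    assume x: "\<forall>j<p. x j \<in> corner ((\<sigma> ^^ j) E)" and fixed: "\<sigma> ?z = ?z"
    have "(\<sigma> ^^ j) ?z = ?z" for j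
      by (induction j) (simp_all add: fixed)
    then have "(\<sigma> ^^ j) (E * ?z * E) = x j" if "j < p" for j
      using compress_sum[of x j] x that by (simp add: funpow_mult)
    then have "mu p \<sigma> (E * ?z * E) = ?z" by (simp add: mu_def)
    moreover have "E * ?z * E \<in> corner E" by (auto simp: corner_def)
    ultimately show "?z \<in> mu p \<sigma> ` corner E" by (metis imageI)
  qed
qed

end

end

section \<open>Content idempotents\<close>

definition content_idem :: "nat \<Rightarrow> nat \<Rightarrow> ((nat \<Rightarrow> int) \<Rightarrow> 'a::ring_1) \<Rightarrow> int multiset \<Rightarrow> 'a" where
  "content_idem e n idem \<beta> = (\<Sum>i\<in>tuples_of_content e n \<beta>. idem i)"

locale orthogonal_residue_idempotents =
  fixes e n :: nat and idem :: "(nat \<Rightarrow> int) \<Rightarrow> 'a::ring_1"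
  assumes idem_mult: "i \<in> residue_tuples e n \<Longrightarrow> j \<in> residue_tuples e n \<Longrightarrow>
      idem i * idem j = (if i = j then idem i else 0)"
begin

abbreviation "eps \<equiv> content_idem e n idem"

lemma tuples_residue: "i \<in> tuples_of_content e n \<beta> \<Longrightarrow> i \<in> residue_tuples e n"
  by (simp add: tuples_of_content_def)

lemma content_idem_mult_idem:
  assumes "i \<in> residue_tuples e n"
  shows "eps \<beta> * idem i = (if i \<in> tuples_of_content e n \<beta> then idem i else 0)"
    and "idem i * eps \<beta> = (if i \<in> tuples_of_content e n \<beta> then idem i else 0)"
proof -
  have "eps \<beta> * idem i = (\<Sum>j\<in>tuples_of_content e n \<beta>. if i = j then idem i else 0)"
    unfolding content_idem_def sum_distrib_right
    by (intro sum.cong refl) (auto simp: idem_mult tuples_residue assms)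
  then show "eps \<beta> * idem i = (if i \<in> tuples_of_content e n \<beta> then idem i else 0)"
    by (simp add: finite_tuples_of_content)
  have "idem i * eps \<beta> = (\<Sum>j\<in>tuples_of_content e n \<beta>. if i = j then idem i else 0)"
    unfolding content_idem_def sum_distrib_left
    by (intro sum.cong refl) (auto simp: idem_mult tuples_residue assms)
  then show "idem i * eps \<beta> = (if i \<in> tuples_of_content e n \<beta> then idem i else 0)"
    by (simp add: finite_tuples_of_content)
qed

lemma content_idem_mult:
  assumes "set_mset \<beta> \<subseteq> {0..<int e}" "set_mset \<gamma> \<subseteq> {0..<int e}"
  shows "eps \<beta> * eps \<gamma> = (if \<beta> = \<gamma> then eps \<beta> else 0)"
proof -
  have "eps \<beta> * eps \<gamma> = (\<Sum>i\<in>tuples_of_content e n \<gamma>. eps \<beta> * idem i)"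
    by (simp add: content_idem_def sum_distrib_left)
  also have "\<dots> = (\<Sum>i\<in>tuples_of_content e n \<gamma>. if \<beta> = \<gamma> then idem i else 0)"
    by (intro sum.cong refl)
      (auto simp: content_idem_mult_idem tuples_residue tuples_of_content_eq assms)
  finally show ?thesis by (simp add: content_idem_def)
qed

text \<open>
  The arbitrary family \<open>h i j\<close> in a block can be replaced by a single element, the block element itself.
\<close>
lemma block_eq_corner: "block e n idem \<beta> = corner (eps \<beta>)"
proof
  let ?I = "tuples_of_content e n \<beta>"
  have "(\<Sum>i\<in>?I. \<Sum>j\<in>?I. idem i * h i j * idem j) \<in> corner (eps \<beta>)" for h :: "(nat \<Rightarrow> int) \<Rightarrow> (nat \<Rightarrow> int) \<Rightarrow> 'a"
  proof -
    let ?z = "\<Sum>i\<in>?I. \<Sum>j\<in>?I. idem i * h i j * idem j"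
    have "eps \<beta> * ?z * eps \<beta> = (\<Sum>i\<in>?I. \<Sum>j\<in>?I. (eps \<beta> * idem i) * h i j * (idem j * eps \<beta>))"
      by (simp add: sum_distrib_left sum_distrib_right mult.assoc)
    also have "\<dots> = ?z"
      by (intro sum.cong refl) (simp add: content_idem_mult_idem tuples_residue)
    finally show ?thesis unfolding corner_def by (metis (mono_tags, lifting) mem_Collect_eq)
  qed
  then show "block e n idem \<beta> \<subseteq> corner (eps \<beta>)" by (auto simp: block_def)
  have "eps \<beta> * x * eps \<beta> = (\<Sum>i\<in>?I. \<Sum>j\<in>?I. idem i * x * idem j)" for x
    by (simp add: content_idem_def sum_distrib_left sum_distrib_right) (rule sum.swap)
  then have "eps \<beta> * x * eps \<beta> \<in> block e n idem \<beta>" for x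
    unfolding block_def by (intro CollectI exI[of _ "\<lambda>_ _. x"]) simp
  then show "corner (eps \<beta>) \<subseteq> block e n idem \<beta>"
    by (auto simp: corner_def)
qed

end

theorem proposition5p22:
  fixes d \<eta> p n e r :: nat
    and \<kappa> :: "nat \<Rightarrow> int"
    and q \<zeta> :: "'f::field"
    and scale :: "'f \<Rightarrow> 'a::ring_1 \<Rightarrow> 'a"
    and S :: 'a and T :: "nat \<Rightarrow> 'a"
    and \<sigma> star :: "'a \<Rightarrow> 'a"
    and idem :: "(nat \<Rightarrow> int) \<Rightarrow> 'a"
    and \<psi> y :: "nat \<Rightarrow> 'a"
    and leq :: "(nat list list \<times> nat list list) set"
    and c :: "nat list list \<Rightarrow> (node \<Rightarrow> nat) \<Rightarrow> (node \<Rightarrow> nat) \<Rightarrow> 'a"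
    and \<alpha> :: "int multiset"
  assumes "d \<ge> 1" "\<eta> \<ge> 1" "p \<ge> 1" "n \<ge> 1" "e = \<eta> * p" "e \<ge> 2" "r = d * p"
    and "\<forall>k<r. \<kappa> k \<in> {0..<int e}"
    and "\<forall>k<r. \<kappa> ((k + d) mod r) = (\<kappa> k + int \<eta>) mod int e"
    and "q \<noteq> 0" "q \<noteq> 1" "has_mult_order q e"
    and "assoc_algebra scale"
    and "assoc_algebra.ariki_koike scale r n q \<kappa> S T"
    and "\<zeta> \<noteq> 0" "has_mult_order \<zeta> p"
    and "assoc_algebra.algebra_automorphism scale \<sigma>"
    and "\<sigma> ^^ p = id" "\<forall>j. 0 < j \<and> j < p \<longrightarrow> \<sigma> ^^ j \<noteq> id"
    and "\<sigma> S = scale \<zeta> S" "\<forall>a\<in>{1..<n}. \<sigma> (T a) = T a"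
    and "assoc_algebra.kl_generators scale e \<eta> n \<sigma> idem \<psi> y"
    and "assoc_algebra.anti_automorphism_on scale UNIV star"
    and "\<forall>i\<in>residue_tuples e n. star (idem i) = idem i"
    and "\<forall>a\<in>{1..<n}. star (\<psi> a) = \<psi> a" "\<forall>a\<in>{1..n}. star (y a) = y a"
    and "assoc_algebra.cellular_datum_with scale UNIV (multipartitions r n) leq
           (standard_tableaux n) c star"
    and "\<forall>lam\<in>multipartitions r n. \<forall>\<ss>\<in>standard_tableaux n lam. \<forall>\<tt>\<in>standard_tableaux n lam.
           c lam \<ss> \<tt> \<in> {idem (res_tableau e \<kappa> n lam \<ss>) * h * idem (res_tableau e \<kappa> n lam \<tt>) | h. True}"
    and "\<alpha> \<in> contents e \<kappa> r n"
    and "card (shift_orbit e \<eta> \<alpha>) = p"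
  shows "assoc_algebra.cellular_datum scale
           (fixed_orbit_block e \<eta> n \<sigma> idem \<alpha>)
           (multipartitions_of_content e \<kappa> r n \<alpha>)
           (leq \<inter> multipartitions_of_content e \<kappa> r n \<alpha> \<times> multipartitions_of_content e \<kappa> r n \<alpha>)
           (standard_tableaux n)
           (\<lambda>lam \<ss> \<tt>. mu p \<sigma> (c lam \<ss> \<tt>))"
proof -
  interpret assoc_algebra scale by fact
  have \<sigma>: "algebra_automorphism \<sigma>" by fact
  have period: "\<sigma> ^^ p = id" by fact
  have kl: "kl_generators e \<eta> n \<sigma> idem \<psi> y" by fact
  have p: "0 < p" and e: "e \<ge> 1" using \<open>p \<ge> 1\<close> \<open>e \<ge> 2\<close> by auto
  interpret orthogonal_residue_idempotents e n idem
    using kl by unfold_locales (auto simp: kl_generators_def)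
  let ?E = "eps \<alpha>" and ?\<Lambda> = "multipartitions_of_content e \<kappa> r n \<alpha>"
  have \<alpha>: "set_mset \<alpha> \<subseteq> {0..<int e}"
    using \<open>\<alpha> \<in> contents e \<kappa> r n\<close> set_mset_content[OF e] by (auto simp: contents_def)
  have shift_range: "set_mset ((shift e \<eta> ^^ j) \<alpha>) \<subseteq> {0..<int e}" for j
    by (rule set_mset_shift_funpow[OF e \<alpha>])

  have \<sigma>_idem: "\<sigma> (idem i) = idem (tuple_minus e \<eta> n i)" if "i \<in> residue_tuples e n" for i
    using kl that by (simp add: kl_generators_def)
  have \<sigma>_eps: "\<sigma> (eps (shift e \<eta> \<beta>)) = eps \<beta>" if "set_mset \<beta> \<subseteq> {0..<int e}" for \<beta>
  proof -
    interpret s: module_hom scale scale \<sigma> by (rule module_hom_automorphism[OF \<sigma>])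
    have "\<sigma> (eps (shift e \<eta> \<beta>)) =
        (\<Sum>i\<in>tuples_of_content e n (shift e \<eta> \<beta>). idem (tuple_minus e \<eta> n i))"
      unfolding content_idem_def s.sum by (intro sum.cong refl) (simp add: \<sigma>_idem tuples_residue)
    also have "\<dots> = eps \<beta>"
      unfolding content_idem_def by (rule sum.reindex_bij_betw[OF bij_betw_tuple_minus[OF e that]])
    finally show ?thesis .
  qed
  have \<sigma>_eps_funpow: "(\<sigma> ^^ k) (eps ((shift e \<eta> ^^ k) \<alpha>)) = ?E" for k
  proof (induction k)
    case (Suc k)
    have "(\<sigma> ^^ Suc k) (eps ((shift e \<eta> ^^ Suc k) \<alpha>)) =
        (\<sigma> ^^ k) (\<sigma> (eps (shift e \<eta> ((shift e \<eta> ^^ k) \<alpha>))))"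
      by (simp add: funpow_swap1)
    then show ?case by (simp only: \<sigma>_eps[OF shift_range] Suc)
  qed simp

  \<comment> \<open>The index runs from \<open>p\<close> downwards since \<open>\<sigma>\<close> acts as the inverse of the shift; \<open>b 0\<close> is \<open>\<alpha>\<close> by periodicity.\<close>
  define b where "b j = (shift e \<eta> ^^ (p - j)) \<alpha>" for j
  have b_eps: "eps (b j) = (\<sigma> ^^ j) ?E" if "j < p" for j
  proof -
    have "(\<sigma> ^^ j) ?E = (\<sigma> ^^ (j + (p - j))) (eps (b j))"
      by (simp add: funpow_add b_def \<sigma>_eps_funpow)
    then show ?thesis using that period by simp
  qed
  have orbit: "shift_orbit e \<eta> \<alpha> = b ` {..<p}"
  proof -
    have "(shift e \<eta> ^^ p) \<alpha> = \<alpha>"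
      using shift_period[of \<alpha> \<eta> p] \<alpha> \<open>e = \<eta> * p\<close> by simp
    from funpow_orbit_backwards[OF p this] show ?thesis
      by (simp add: shift_orbit_def b_def)
  qed
  \<comment> \<open>This is where maximality of the orbit enters: without it two translates of \<open>E\<close> would coincide.\<close>
  have b_inj: "inj_on b {..<p}"
    using \<open>card (shift_orbit e \<eta> \<alpha>) = p\<close> by (intro eq_card_imp_inj_on) (simp_all add: orbit)
  have orth: "(\<sigma> ^^ i) ?E * (\<sigma> ^^ j) ?E = (if i = j then (\<sigma> ^^ i) ?E else 0)"
    if "i < p" "j < p" for i j
  proof -
    have "eps (b i) * eps (b j) = (if b i = b j then eps (b i) else 0)"
      by (rule content_idem_mult) (simp_all add: b_def shift_range)
    moreover have "b i = b j \<longleftrightarrow> i = j" using b_inj that by (auto simp: inj_on_def)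
    ultimately show ?thesis using that by (simp add: b_eps)
  qed

  \<comment> \<open>Only the indexing of the orbit, by contents or by powers of \<open>\<sigma>\<close>, has to be exchanged here.\<close>
  have image: "mu p \<sigma> ` corner ?E = fixed_orbit_block e \<eta> n \<sigma> idem \<alpha>"
  proof -
    have "orbit_block e \<eta> n idem \<alpha> =
        {z. \<exists>x. z = (\<Sum>j<p. x j) \<and> (\<forall>j<p. x j \<in> corner ((\<sigma> ^^ j) ?E))}" (is "_ = ?R")
    proof
      show "orbit_block e \<eta> n idem \<alpha> \<subseteq> ?R"
      proof
        fix z assume "z \<in> orbit_block e \<eta> n idem \<alpha>"
        then obtain x where x: "z = (\<Sum>\<beta>\<in>b ` {..<p}. x \<beta>)" "\<forall>j<p. x (b j) \<in> corner (eps (b j))"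
          by (auto simp: orbit_block_def orbit block_eq_corner)
        then have "z = (\<Sum>j<p. (x \<circ> b) j)" "\<forall>j<p. (x \<circ> b) j \<in> corner ((\<sigma> ^^ j) ?E)"
          by (simp_all add: sum.reindex[OF b_inj] b_eps)
        then show "z \<in> ?R" by blast
      qed
      show "?R \<subseteq> orbit_block e \<eta> n idem \<alpha>"
      proof
        fix z assume "z \<in> ?R"
        then obtain x where x: "z = (\<Sum>j<p. x j)" "\<forall>j<p. x j \<in> corner ((\<sigma> ^^ j) ?E)" by blast
        let ?x = "x \<circ> inv_into {..<p} b"
        have inv: "inv_into {..<p} b (b j) = j" if "j < p" for j
          using b_inj that by simp
        have "z = (\<Sum>\<beta>\<in>b ` {..<p}. ?x \<beta>)" "\<forall>\<beta>\<in>b ` {..<p}. ?x \<beta> \<in> block e n idem \<beta>"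
          using x by (simp_all add: sum.reindex[OF b_inj] inv b_eps block_eq_corner)
        then show "z \<in> orbit_block e \<eta> n idem \<alpha>"
          unfolding orbit_block_def orbit by blast
      qed
    qed
    then show ?thesis
      by (simp add: fixed_orbit_block_def mu_image_corner[OF \<sigma> p orth period])
  qed

  have cut: "?E * c lam s t * ?E = (if content e \<kappa> lam = \<alpha> then c lam s t else 0)"
    if lam: "lam \<in> multipartitions r n" and s: "s \<in> standard_tableaux n lam"
      and t: "t \<in> standard_tableaux n lam" for lam s t
  proof -
    let ?i = "res_tableau e \<kappa> n lam s" and ?j = "res_tableau e \<kappa> n lam t"
    obtain h where h: "c lam s t = idem ?i * h * idem ?j"
      using bspec[OF bspec[OF bspec[OF assms(28) lam] s] t] by blast
    have ij: "?i \<in> tuples_of_content e n (content e \<kappa> lam)" "?j \<in> tuples_of_content e n (content e \<kappa> lam)"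
      using res_tableau_in_tuples_of_content[OF e] s t by blast+
    then have "?i \<in> tuples_of_content e n \<alpha> \<longleftrightarrow> content e \<kappa> lam = \<alpha>"
      by (auto simp: tuples_of_content_eq[OF \<alpha>] tuples_of_content_eq[OF set_mset_content[OF e]])
    moreover have "?E * c lam s t * ?E = (?E * idem ?i) * h * (idem ?j * ?E)"
      by (simp add: h mult.assoc)
    ultimately show ?thesis
      using ij h by (auto simp: content_idem_mult_idem tuples_residue)
  qed
  have "cellular_datum_with (corner ?E) ?\<Lambda> (leq \<inter> ?\<Lambda> \<times> ?\<Lambda>) (standard_tableaux n) c star"
  proof (rule cellular_datum_with_corner)
    show "cellular_datum_with UNIV (multipartitions r n) leq (standard_tableaux n) c star" by fact
    show "?E * ?E = ?E" using orth[of 0 0] p by simp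
    show "star ?E = ?E"
    proof -
      have "module_hom scale scale star"
        using \<open>anti_automorphism_on UNIV star\<close>
        by unfold_locales (simp_all add: anti_automorphism_on_def scale_right_distrib scale_left_distrib)
      then show ?thesis
        using \<open>\<forall>i\<in>residue_tuples e n. star (idem i) = idem i\<close>
        by (simp add: content_idem_def module_hom.sum tuples_residue)
    qed
  qed (auto simp: multipartitions_of_content_def cut)
  from cellular_datum_transport[OF this module_hom_mu[OF \<sigma>]
      inj_on_mu_corner[OF \<sigma> p orth] mu_mult_on_corner[OF \<sigma> p orth]]
  show ?thesis unfolding image .
qed

end
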